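(* There exists a sequence $\{c_j\}_{j\ge 0}$ of nonzero real numbers such that, for the sequence $\Phi_*=\{\Phi_k\}_{k\ge 1}$ defined by $\Phi_k=M(c_{j(k)})$, where $j(k)$ is the largest integer $j\ge 0$ such that $2^j$ divides $k$, the set $\mathfrak B(\Phi_* )$ is essentially unbounded, that is, $|\mathfrak B(\Phi_* )\cap[a,+\infty)|>0$ for all $a>0$.
   Context: For $t,c\in\mathbb{R}$, $H(t)=\begin{pmatrix}1&t\\0&1\end{pmatrix}$ and $M(c)=\begin{pmatrix}1&0\\c&1\end{pmatrix}$. For a sequence $\Phi_*=\{\Phi_k\}_{k\ge1}$ in $SL(2,\mathbb{R})$, $\mathfrak B(\Phi_* )=\{t\ge 0:\ \sup_{K\ge 1}\|\Phi_KH(t)\,\Phi_{K-1}H(t)\cdots\Phi_1H(t)\|<\infty\}$, where $\|\cdot\|$ is the operator norm induced by the Euclidean norm. $|F|$ denotes the Lebesgue measure of $F\subset\mathbb{R}$. *)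

theory Defs
  imports "HOL-Analysis.Analysis"
begin

definition Hmat :: "real \<Rightarrow> real^2^2" where
  "Hmat t = vector [vector [1, t], vector [0, 1]]"

definition Mmat :: "real \<Rightarrow> real^2^2" where
  "Mmat c = vector [vector [1, 0], vector [c, 1]]"

lemma det_Hmat: "det (Hmat t) = 1"
  by (simp add: Hmat_def det_2)

lemma det_Mmat: "det (Mmat c) = 1"
  by (simp add: Mmat_def det_2)

text \<open>
  Sequences of matrices are indexed from 1; the value of \<open>\<Phi>\<close> at 0 is never used.
  For \<open>K \<ge> 1\<close>, \<open>kick_prod \<Phi> t K\<close> is the product
  \<open>\<Phi> K ** Hmat t ** \<Phi> (K - 1) ** Hmat t ** \<dots> ** \<Phi> 1 ** Hmat t\<close>.
\<close>

primrec kick_prod :: "(nat \<Rightarrow> real^2^2) \<Rightarrow> real \<Rightarrow> nat \<Rightarrow> real^2^2" where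
  "kick_prod \<Phi> t 0 = mat 1"
| "kick_prod \<Phi> t (Suc K) = \<Phi> (Suc K) ** Hmat t ** kick_prod \<Phi> t K"

definition bounded_times :: "(nat \<Rightarrow> real^2^2) \<Rightarrow> real set" where
  "bounded_times \<Phi> =
     {t. t \<ge> 0 \<and> bdd_above ((\<lambda>K. onorm ((*v) (kick_prod \<Phi> t K))) ` {1..})}"

text \<open>
  A set that is not Lebesgue measurable has \<open>emeasure lebesgue\<close> equal to 0 by convention,
  so positivity below includes measurability.
\<close>

definition essentially_unbounded :: "real set \<Rightarrow> bool" where
  "essentially_unbounded F \<longleftrightarrow> (\<forall>a>0. emeasure lebesgue (F \<inter> {a..}) > 0)"

end

theory Submission
  imports Defs
begin

text \<open>
  The product of the first \<open>2^n\<close> factors is \<open>M(c\<^sub>n) P\<^sub>n\<close>, where \<open>P\<^sub>0 = H(t)\<close> and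
  \<open>P\<^sub>n\<^sub>+\<^sub>1 = P\<^sub>n M(c\<^sub>n) P\<^sub>n\<close> (\<open>block_Suc\<close>, \<open>kick_prod_power\<close>). The block \<open>P\<^sub>n\<close> is a palindrome
  in matrices with equal diagonal entries, so it has the form \<open>(x y; z x)\<close> with entries polynomial
  in \<open>t\<close>. If \<open>x\<^sup>2 < 1\<close> it is elliptic, and it is then an isometry of the diagonal quadratic form
  \<open>\<rho>\<^sub>n u\<^sup>2 + v\<^sup>2\<close> with \<open>\<rho>\<^sub>n = (1 - x\<^sup>2) / y\<^sup>2\<close>. Two mechanisms are balanced against each other.

  A tiny kick does little harm. For \<open>c\<^sub>n = 0\<close> one has \<open>P\<^sub>n\<^sub>+\<^sub>1 = P\<^sub>n\<^sup>2\<close>, which preserves the same form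
  as \<open>P\<^sub>n\<close> and is again elliptic unless \<open>x = 0\<close>, a condition on \<open>t\<close> with finitely many solutions.
  Hence, for almost every elliptic \<open>t\<close>, a sufficiently small \<open>c\<^sub>n\<close> keeps the block elliptic and
  changes the form by a factor \<open>1 + O(2^-n)\<close> only. If this holds at every scale from some point
  on, the products are bounded (\<open>bounded_of_good_steps\<close>).

  A tiny kick can nevertheless create ellipticity at a large time. The entries satisfy
  \<open>y / x \<rightarrow> \<infinity>\<close> as \<open>t \<rightarrow> \<infinity>\<close> (\<open>block_growth\<close>), so the value of \<open>c\<^sub>n\<close> for which the diagonal of
  \<open>P\<^sub>n\<^sub>+\<^sub>1\<close> vanishes at \<open>t = s\<close> tends to \<open>0\<close> as \<open>s \<rightarrow> \<infinity>\<close>. Near \<open>s\<close> the block \<open>P\<^sub>n\<^sub>+\<^sub>1\<close> is elliptic.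

  The kicks are chosen recursively (\<open>admissible_exists\<close>): \<open>c\<^sub>n\<close> opens a new elliptic set beyond time
  \<open>n\<close>, and by dominated convergence it can be taken so small that each earlier elliptic set retains
  more than half of its original measure. What remains of these sets in the limit has positive
  measure, lies arbitrarily far out, and consists of bounded times.
\<close>

section \<open>Palindromic blocks of the ruler sequence\<close>

text \<open>
  The entries of the blocks \<open>P\<^sub>n\<close>. Treating them as polynomials in the time \<open>t\<close> gives continuity
  and finiteness of zero sets at once.
\<close>

fun diag_poly :: "(nat \<Rightarrow> real) \<Rightarrow> nat \<Rightarrow> real poly"
  and upper_poly :: "(nat \<Rightarrow> real) \<Rightarrow> nat \<Rightarrow> real poly"
  and lower_poly :: "(nat \<Rightarrow> real) \<Rightarrow> nat \<Rightarrow> real poly" where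
  "diag_poly c 0 = 1"
| "upper_poly c 0 = [:0, 1:]"
| "lower_poly c 0 = 0"
| "diag_poly c (Suc n) = diag_poly c n * (2 * diag_poly c n + smult (c n) (upper_poly c n)) - 1"
| "upper_poly c (Suc n) = upper_poly c n * (2 * diag_poly c n + smult (c n) (upper_poly c n))"
| "lower_poly c (Suc n) = diag_poly c n * (2 * lower_poly c n + smult (c n) (diag_poly c n))"

abbreviation "block_x c n t \<equiv> poly (diag_poly c n) t"
abbreviation "block_y c n t \<equiv> poly (upper_poly c n) t"
abbreviation "block_z c n t \<equiv> poly (lower_poly c n) t"

definition block :: "(nat \<Rightarrow> real) \<Rightarrow> nat \<Rightarrow> real \<Rightarrow> real^2^2" where
  "block c n t = vector [vector [block_x c n t, block_y c n t], vector [block_z c n t, block_x c n t]]"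

lemma poly_cong_prefix:
  assumes "\<And>j. j < n \<Longrightarrow> c j = c' j"
  shows "diag_poly c n = diag_poly c' n" "upper_poly c n = upper_poly c' n"
proof -
  have "diag_poly c n = diag_poly c' n \<and> upper_poly c n = upper_poly c' n"
    using assms by (induction n) auto
  then show "diag_poly c n = diag_poly c' n" "upper_poly c n = upper_poly c' n" by auto
qed

text \<open>The blocks have determinant \<open>1\<close>; in particular, \<open>y\<close> cannot vanish where \<open>x\<^sup>2 < 1\<close>.\<close>

lemma block_det: "(block_x c n t)\<^sup>2 - block_y c n t * block_z c n t = 1"
proof (induction n)
  case (Suc n)
  then have *: "block_y c n t * block_z c n t = (block_x c n t)\<^sup>2 - 1" by simp
  have "(block_x c (Suc n) t)\<^sup>2 - block_y c (Suc n) t * block_z c (Suc n) t - 1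
     = block_x c n t * (2 * block_x c n t + c n * block_y c n t)
       * (block_x c n t * (2 * block_x c n t + c n * block_y c n t) - 2
          - 2 * (block_y c n t * block_z c n t) - c n * block_x c n t * block_y c n t)"
    by (simp add: algebra_simps power2_eq_square)
  also have "\<dots> = 0" unfolding * by (simp add: algebra_simps power2_eq_square)
  finally show ?case by simp
qed simp

lemma mat2_eqI:
  fixes A B :: "real^2^2"
  assumes "A$1$1 = B$1$1" "A$1$2 = B$1$2" "A$2$1 = B$2$1" "A$2$2 = B$2$2"
  shows "A = B"
  using assms by (simp add: vec_eq_iff forall_2)

lemma block_0: "block c 0 t = Hmat t"
  by (simp add: block_def Hmat_def)

text \<open>
  The recursion of the polynomials uses the determinant identity to write the diagonal entry
  \<open>x\<^sup>2 + y z + c x y\<close> of \<open>P\<^sub>n M(c) P\<^sub>n\<close> as \<open>2 x\<^sup>2 - 1 + c x y\<close>.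
\<close>

lemma block_Suc: "block c (Suc n) t = block c n t ** (Mmat (c n) ** block c n t)"
proof -
  have *: "block_y c n t * block_z c n t = (block_x c n t)\<^sup>2 - 1"
    using block_det[of c n t] by simp
  have "block_x c n t * block_x c n t = 1 + block_y c n t * block_z c n t"
    using * by (simp add: power2_eq_square)
  then show ?thesis
    by (intro mat2_eqI)
      (auto simp: block_def Mmat_def matrix_matrix_mult_def sum_2 algebra_simps)
qed

text \<open>The self-similarity of the ruler sequence: after position \<open>2^n\<close> it starts afresh.\<close>

lemma multiplicity_two_shift:
  assumes "0 < i" "i < 2 ^ n"
  shows "multiplicity 2 (2 ^ n + i) = multiplicity 2 (i::nat)"
proof -
  have "2 ^ multiplicity 2 i \<le> i"
    using assms by (intro dvd_imp_le multiplicity_dvd) auto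
  then have "(2::nat) ^ multiplicity 2 i < 2 ^ n" using assms by linarith
  then have "multiplicity 2 i < n" by simp
  then have "multiplicity 2 i < multiplicity 2 (2 ^ n :: nat)" by simp
  then show ?thesis using assms
    by (subst add.commute, intro multiplicity_sum_lt) auto
qed

abbreviation ruler :: "(nat \<Rightarrow> real) \<Rightarrow> nat \<Rightarrow> real^2^2" where
  "ruler c \<equiv> (\<lambda>k. Mmat (c (multiplicity 2 k)))"

lemma kick_prod_shift:
  assumes "i < 2 ^ n"
  shows "kick_prod (ruler c) t (2 ^ n + i) = kick_prod (ruler c) t i ** kick_prod (ruler c) t (2 ^ n)"
  using assms
proof (induction i)
  case (Suc i)
  then show ?case
    using multiplicity_two_shift[of "Suc i" n] by (simp add: matrix_mul_assoc)
qed simp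

lemma kick_prod_power:
  assumes "block c n t = Hmat t ** kick_prod (ruler c) t (2 ^ n - 1)"
  shows "kick_prod (ruler c) t (2 ^ n) = Mmat (c n) ** block c n t"
proof -
  obtain m where m: "2 ^ n = Suc m" by (metis not0_implies_Suc power_not_zero zero_neq_numeral)
  have "multiplicity 2 (Suc m) = n" by (simp flip: m)
  then show ?thesis using assms by (simp add: m matrix_mul_assoc)
qed

text \<open>
  The first \<open>2^n - 1\<close> factors contain all the kicks of the palindrome \<open>P\<^sub>n\<close> and all of its \<open>H(t)\<close>
  but the leftmost one.
\<close>

lemma block_eq_kick_prod: "block c n t = Hmat t ** kick_prod (ruler c) t (2 ^ n - 1)"
proof (induction n)
  case 0
  then show ?case by (simp add: block_0)
next
  case (Suc n)
  have "2 ^ Suc n - 1 = 2 ^ n + (2 ^ n - 1 :: nat)"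
    by simp
  then have "kick_prod (ruler c) t (2 ^ Suc n - 1)
      = kick_prod (ruler c) t (2 ^ n - 1) ** (Mmat (c n) ** block c n t)"
    using kick_prod_shift[of "2 ^ n - 1" n c t] kick_prod_power[OF Suc] by simp
  then show ?case using Suc by (simp add: block_Suc matrix_mul_assoc)
qed

lemma kick_prod_split:
  assumes "i < 2 ^ n"
  shows "kick_prod (ruler c) t (2 ^ n + i) = kick_prod (ruler c) t i ** (Mmat (c n) ** block c n t)"
  using kick_prod_shift[OF assms] kick_prod_power[OF block_eq_kick_prod] by simp

section \<open>Adapted quadratic forms and boundedness\<close>

definition form :: "real \<Rightarrow> real^2 \<Rightarrow> real" where
  "form \<rho> v = \<rho> * (v$1)\<^sup>2 + (v$2)\<^sup>2"

text \<open>
  The weight \<open>\<rho>\<close> for which an elliptic block is an isometry of \<open>form \<rho>\<close>; by the determinant identity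
  it equals \<open>- z / y\<close>.
\<close>

definition ratio :: "(nat \<Rightarrow> real) \<Rightarrow> nat \<Rightarrow> real \<Rightarrow> real" where
  "ratio c n t = (1 - (block_x c n t)\<^sup>2) / (block_y c n t)\<^sup>2"

lemma block_y_nonzero:
  assumes "(block_x c n t)\<^sup>2 < 1"
  shows "block_y c n t \<noteq> 0"
  using block_det[of c n t] assms by auto

lemma ratio_pos:
  assumes "(block_x c n t)\<^sup>2 < 1"
  shows "0 < ratio c n t"
  using assms block_y_nonzero[OF assms] by (simp add: ratio_def)

lemma form_block:
  assumes "(block_x c n t)\<^sup>2 < 1"
  shows "form (ratio c n t) (block c n t *v v) = form (ratio c n t) v"
proof -
  let ?x = "block_x c n t" and ?y = "block_y c n t" and ?z = "block_z c n t" and ?r = "ratio c n t"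
  have y: "?y \<noteq> 0" by (rule block_y_nonzero[OF assms])
  have d: "?x\<^sup>2 - 1 = ?y * ?z" using block_det[of c n t] by simp
  have "?r * ?y\<^sup>2 = 1 - ?x\<^sup>2" using y by (simp add: ratio_def)
  also have "\<dots> = - (?y * ?z)" using d by simp
  finally have "?y * (?r * ?y) = ?y * (- ?z)" by (simp add: power2_eq_square mult_ac)
  then have "?r * ?y = - ?z" using y mult_left_cancel by blast
  then have z: "?z = - ?r * ?y" by simp
  have d': "?x\<^sup>2 + ?r * ?y\<^sup>2 = 1" using d z by (simp add: power2_eq_square algebra_simps)
  have "form ?r (block c n t *v v) = (?x\<^sup>2 + ?r * ?y\<^sup>2) * form ?r v"
    by (simp add: form_def block_def matrix_vector_mult_def sum_2 z algebra_simps power2_eq_square)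
  then show ?thesis using d' by simp
qed

text \<open>
  The cross term \<open>2 c u w\<close> is split by Young's inequality with weight \<open>\<eta>\<close>, which is why a kick is
  measured against the square root of \<open>\<rho>\<close>.
\<close>

lemma form_Mmat_le:
  assumes "0 < \<eta>" "0 \<le> \<rho>" "c\<^sup>2 \<le> \<eta>\<^sup>2 * \<rho>"
  shows "form \<rho> (Mmat c *v v) \<le> (1 + \<eta>)\<^sup>2 * form \<rho> v"
proof -
  let ?u = "v$1" and ?w = "v$2"
  have young: "\<eta> * (2 * (c * ?u) * ?w) \<le> \<eta>\<^sup>2 * ?w\<^sup>2 + (c * ?u)\<^sup>2"
    using sum_squares_bound[of "\<eta> * ?w" "c * ?u"] by (simp add: algebra_simps power2_eq_square)
  have cu: "(c * ?u)\<^sup>2 \<le> \<eta>\<^sup>2 * (\<rho> * ?u\<^sup>2)"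
    using mult_right_mono[OF assms(3), of "?u\<^sup>2"] by (simp add: power_mult_distrib algebra_simps)
  have "\<eta> * (2 * (c * ?u) * ?w) \<le> \<eta> * (\<eta> * (?w\<^sup>2 + \<rho> * ?u\<^sup>2))"
    using young cu by (simp add: algebra_simps power2_eq_square)
  then have cross: "2 * (c * ?u) * ?w \<le> \<eta> * (?w\<^sup>2 + \<rho> * ?u\<^sup>2)"
    using assms(1) mult_le_cancel_left_pos by blast
  have "form \<rho> (Mmat c *v v) = \<rho> * ?u\<^sup>2 + ((c * ?u)\<^sup>2 + 2 * (c * ?u) * ?w + ?w\<^sup>2)"
    by (simp add: form_def Mmat_def matrix_vector_mult_def sum_2 algebra_simps power2_eq_square)
  also have "\<dots> \<le> \<rho> * ?u\<^sup>2 + (\<eta>\<^sup>2 * (\<rho> * ?u\<^sup>2) + \<eta> * (?w\<^sup>2 + \<rho> * ?u\<^sup>2) + ?w\<^sup>2)"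
    using cu cross by linarith
  also have "\<dots> \<le> \<rho> * ?u\<^sup>2 + (\<eta>\<^sup>2 * (\<rho> * ?u\<^sup>2) + \<eta> * (?w\<^sup>2 + \<rho> * ?u\<^sup>2) + ?w\<^sup>2)
       + (\<eta>\<^sup>2 * ?w\<^sup>2 + \<eta> * (?w\<^sup>2 + \<rho> * ?u\<^sup>2))"
    using assms by simp
  also have "\<dots> = (1 + \<eta>)\<^sup>2 * form \<rho> v"
    by (simp add: form_def algebra_simps power2_eq_square)
  finally show ?thesis .
qed

lemma form_nonneg: "0 \<le> \<rho> \<Longrightarrow> 0 \<le> form \<rho> v"
  by (simp add: form_def)

lemma norm_vec2_sq: "(norm (v :: real^2))\<^sup>2 = (v$1)\<^sup>2 + (v$2)\<^sup>2"
  unfolding power2_norm_eq_inner by (simp add: inner_vec_def sum_2 power2_eq_square)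

text \<open>
  A step is good if the next block is elliptic and the passage from scale \<open>n\<close> to \<open>n + 1\<close> costs at
  most a factor \<open>1 + 2^-n\<close> in each comparison. The summable sequence \<open>2^-n\<close> makes the product of
  all these factors converge.
\<close>

definition good_step :: "(nat \<Rightarrow> real) \<Rightarrow> nat \<Rightarrow> real \<Rightarrow> bool" where
  "good_step c n t \<longleftrightarrow>
     (block_x c (Suc n) t)\<^sup>2 < 1
   \<and> ratio c n t \<le> (1 + (1/2)^n) * ratio c (Suc n) t
   \<and> ratio c (Suc n) t \<le> (1 + (1/2)^n) * ratio c n t
   \<and> (c n)\<^sup>2 \<le> ((1/2)^n)\<^sup>2 * ratio c n t"

text \<open>
  By induction on \<open>n\<close>, all products of fewer than \<open>2^n\<close> factors are bounded relative to the form
  of scale \<open>n\<close>: a product of \<open>2^n + i\<close> factors applies first \<open>M(c\<^sub>n) P\<^sub>n\<close>, where \<open>P\<^sub>n\<close> is an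
  isometry of the form and the kick nearly so, and then a product of \<open>i < 2^n\<close> factors. Each scale
  costs a factor at most \<open>(1 + 2^-n)^3\<close>. The forms themselves stay comparable to
  the Euclidean norm because the weights \<open>\<rho>\<^sub>n\<close> change by summable amounts.
\<close>

lemma bounded_of_good_steps:
  assumes start: "(block_x c m t)\<^sup>2 < 1" and good: "\<And>n. m \<le> n \<Longrightarrow> good_step c n t"
  obtains B where "\<And>K v. norm (kick_prod (ruler c) t K *v v) \<le> B * norm v"
proof -
  let ?kp = "kick_prod (ruler c) t"
  define S where "S n = (\<Sum>j<n. (1/2::real)^j)" for n
  have S_bound: "S n \<le> 2" for n
    unfolding S_def using sum_le_suminf[of "\<lambda>j. (1/2::real)^j" "{..<n}"] suminf_geometric[of "1/2::real"]
    by (simp add: summable_geometric)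
  have exp_eta: "1 + (1/2)^n \<le> exp ((1/2::real)^n)" for n by (rule exp_ge_add_one_self)
  have ell: "(block_x c n t)\<^sup>2 < 1" if "m \<le> n" for n
    using that by (induction n rule: dec_induct) (use start good in \<open>auto simp: good_step_def\<close>)
  let ?r = "\<lambda>n. ratio c n t"
  have r_pos: "0 < ?r n" if "m \<le> n" for n using ratio_pos ell that by blast
  \<comment> \<open>Below scale \<open>m\<close> there are only finitely many products, so a crude bound suffices.\<close>
  have "\<exists>N. \<forall>K<2^m. \<forall>v. norm (?kp K *v v) \<le> N * norm v"
  proof -
    define N where "N = (\<Sum>K<2^m. onorm ((*v) (?kp K)))"
    have "norm (?kp K *v v) \<le> N * norm v" if "K < 2^m" for K v
    proof -
      have "onorm ((*v) (?kp K)) \<le> N" unfolding N_def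
        using that by (intro member_le_sum onorm_pos_le) (auto simp: matrix_vector_mul_bounded_linear)
      then show ?thesis
        using onorm[OF matrix_vector_mul_bounded_linear, of "?kp K" v]
        by (meson mult_right_mono norm_ge_zero order_trans)
    qed
    then show ?thesis by blast
  qed
  then obtain N where N: "\<And>K v. K < 2^m \<Longrightarrow> norm (?kp K *v v) \<le> N * norm v" by blast
  define \<mu> where "\<mu> = min 1 (?r m)"
  have \<mu>: "0 < \<mu>" using r_pos[of m] by (simp add: \<mu>_def)
  define C where "C = N\<^sup>2 / \<mu>"
  have C0: "0 \<le> C" using \<mu> by (simp add: C_def)
  have main: "\<forall>K<2^n. \<forall>v. (norm (?kp K *v v))\<^sup>2 \<le> C * exp (3 * S n) * form (?r n) v" if "m \<le> n" for n
    using that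
  proof (induction n rule: dec_induct)
    case base
    show ?case
    proof (intro allI impI)
      fix K :: nat and v :: "real^2" assume "K < 2^m"
      have "(norm (?kp K *v v))\<^sup>2 \<le> (N * norm v)\<^sup>2"
        using N[OF \<open>K < 2^m\<close>] by (intro power_mono) auto
      also have "\<dots> = C * (\<mu> * (norm v)\<^sup>2)" using \<mu> by (simp add: C_def power_mult_distrib)
      also have "\<dots> \<le> C * form (?r m) v"
      proof -
        have "\<mu> * (v$1)\<^sup>2 \<le> ?r m * (v$1)\<^sup>2" "\<mu> * (v$2)\<^sup>2 \<le> 1 * (v$2)\<^sup>2"
          by (intro mult_right_mono; simp add: \<mu>_def)+
        then have "\<mu> * (norm v)\<^sup>2 \<le> form (?r m) v"
          by (simp add: norm_vec2_sq form_def algebra_simps)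
        then show ?thesis using C0 mult_left_mono by blast
      qed
      also have "\<dots> \<le> C * exp (3 * S m) * form (?r m) v"
      proof -
        have "0 \<le> S m" by (simp add: S_def sum_nonneg)
        then have "1 \<le> exp (3 * S m)" by simp
        then have "C * 1 \<le> C * exp (3 * S m)" using C0 by (intro mult_left_mono) auto
        then show ?thesis using form_nonneg[of "?r m" v] r_pos[of m] by (intro mult_right_mono) auto
      qed
      finally show "(norm (?kp K *v v))\<^sup>2 \<le> C * exp (3 * S m) * form (?r m) v" .
    qed
  next
    case (step n)
    let ?e = "(1/2::real)^n"
    let ?D = "C * exp (3 * S n)"
    have D0: "0 \<le> ?D" using C0 by simp
    note g = good[OF step(1), unfolded good_step_def]
    have r: "0 < ?r n" "0 < ?r (Suc n)" using r_pos step(1) by auto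
    have cmp: "form (?r n) v \<le> (1 + ?e) * form (?r (Suc n)) v" for v
    proof -
      have "?r n * (v$1)\<^sup>2 \<le> (1 + ?e) * ?r (Suc n) * (v$1)\<^sup>2" 
        using g by (intro mult_right_mono) auto
      moreover have "1 * (v$2)\<^sup>2 \<le> (1 + ?e) * (v$2)\<^sup>2" by (intro mult_right_mono) auto
      ultimately show ?thesis
        unfolding form_def distrib_left mult.assoc[symmetric] by linarith
    qed
    have both: "(norm (?kp K *v v))\<^sup>2 \<le> ?D * ((1 + ?e)\<^sup>2 * form (?r n) v)" if "K < 2 ^ Suc n" for K v
    proof (cases "K < 2^n")
      case True
      then have "(norm (?kp K *v v))\<^sup>2 \<le> ?D * (1 * form (?r n) v)" using step by simp
      also have "\<dots> \<le> ?D * ((1 + ?e)\<^sup>2 * form (?r n) v)"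
        using r form_nonneg[of "?r n" v]
        by (intro mult_left_mono mult_right_mono D0) (auto intro: one_le_power)
      finally show ?thesis .
    next
      case False
      then obtain i where i: "K = 2^n + i" by (metis le_add_diff_inverse not_le)
      then have "i < 2^n" using that by simp
      then have "?kp K *v v = ?kp i *v (Mmat (c n) *v (block c n t *v v))"
        by (simp add: i kick_prod_split matrix_vector_mul_assoc matrix_mul_assoc)
      then have "(norm (?kp K *v v))\<^sup>2 \<le> ?D * form (?r n) (Mmat (c n) *v (block c n t *v v))"
        using step.IH \<open>i < 2^n\<close> by simp
      also have "\<dots> \<le> ?D * ((1 + ?e)\<^sup>2 * form (?r n) (block c n t *v v))"
        using g r by (intro mult_left_mono D0 form_Mmat_le) auto
      also have "\<dots> = ?D * ((1 + ?e)\<^sup>2 * form (?r n) v)"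
        using form_block[OF ell[OF step(1)]] by simp
      finally show ?thesis .
    qed
    have e3: "(1 + ?e)\<^sup>2 * (1 + ?e) \<le> exp (3 * ?e)"
    proof -
      have "(1 + ?e)^3 \<le> exp ?e ^ 3" by (intro power_mono exp_eta) auto
      also have "\<dots> = exp (3 * ?e)" using exp_of_nat_mult[of 3 ?e] by simp
      finally show ?thesis by (simp only: power2_eq_square power3_eq_cube)
    qed
    show ?case
    proof (intro allI impI)
      fix K :: nat and v :: "real^2" assume K: "K < 2 ^ Suc n"
      have "(norm (?kp K *v v))\<^sup>2 \<le> ?D * ((1 + ?e)\<^sup>2 * form (?r n) v)" by (rule both[OF K])
      also have "\<dots> \<le> ?D * ((1 + ?e)\<^sup>2 * ((1 + ?e) * form (?r (Suc n)) v))"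
        by (intro mult_left_mono D0 cmp) auto
      also have "\<dots> = ?D * (((1 + ?e)\<^sup>2 * (1 + ?e)) * form (?r (Suc n)) v)" by simp
      also have "\<dots> \<le> ?D * (exp (3 * ?e) * form (?r (Suc n)) v)"
        using r by (intro mult_left_mono mult_right_mono D0 e3 form_nonneg) auto
      also have "\<dots> = C * exp (3 * S (Suc n)) * form (?r (Suc n)) v"
        by (simp add: S_def exp_add distrib_left)
      finally show "(norm (?kp K *v v))\<^sup>2 \<le> C * exp (3 * S (Suc n)) * form (?r (Suc n)) v" .
    qed
  qed
  have r_le: "?r n \<le> ?r m * exp (S n)" if "m \<le> n" for n
    using that
  proof (induction n rule: dec_induct)
    case base
    have "1 \<le> exp (S m)" by (simp add: S_def sum_nonneg)
    then show ?case using r_pos[of m] by simp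
  next
    case (step n)
    have "?r (Suc n) \<le> (1 + (1/2)^n) * ?r n"
      using good[OF step(1)] by (simp add: good_step_def)
    also have "\<dots> \<le> exp ((1/2)^n) * (?r m * exp (S n))"
      using r_pos[OF step(1)] by (intro mult_mono exp_eta step.IH) auto
    also have "\<dots> = ?r m * exp (S (Suc n))" by (simp add: S_def exp_add)
    finally show ?case .
  qed
  define R where "R = max 1 (?r m * exp 2)"
  define B where "B = sqrt (C * exp 6 * R)"
  have R1: "1 \<le> R" by (simp add: R_def)
  have "norm (?kp K *v v) \<le> B * norm v" for K v
  proof -
    define n where "n = max m K"
    have mn: "m \<le> n" by (simp add: n_def)
    have "K < 2^K" by (rule less_exp)
    also have "(2::nat)^K \<le> 2^n" by (intro power_increasing) (auto simp: n_def)
    finally have "K < 2^n" .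
    then have "(norm (?kp K *v v))\<^sup>2 \<le> C * exp (3 * S n) * form (?r n) v"
      using main[OF mn] by blast
    also have "\<dots> \<le> C * exp 6 * (R * (norm v)\<^sup>2)"
    proof (intro mult_mono mult_left_mono C0)
      show "exp (3 * S n) \<le> exp 6" using S_bound[of n] by simp
      have "?r n \<le> ?r m * exp 2"
        using r_le[OF mn] S_bound[of n] r_pos[of m]
        by (meson exp_le_cancel_iff less_imp_le mult_left_mono order_refl order_trans)
      then have "?r n \<le> R" by (simp add: R_def)
      then have "?r n * (v$1)\<^sup>2 \<le> R * (v$1)\<^sup>2" "1 * (v$2)\<^sup>2 \<le> R * (v$2)\<^sup>2"
        using R1 by (intro mult_right_mono; simp)+
      then show "form (?r n) v \<le> R * (norm v)\<^sup>2"
        by (simp add: form_def norm_vec2_sq algebra_simps)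
      show "0 \<le> form (?r n) v" using r_pos[OF mn] by (intro form_nonneg) auto
    qed (use C0 in auto)
    finally have "(norm (?kp K *v v))\<^sup>2 \<le> (C * exp 6 * R) * (norm v)\<^sup>2" by simp
    then have "sqrt ((norm (?kp K *v v))\<^sup>2) \<le> sqrt ((C * exp 6 * R) * (norm v)\<^sup>2)"
      by (rule real_sqrt_le_mono)
    then show ?thesis by (simp add: B_def real_sqrt_mult)
  qed
  then show ?thesis using that by blast
qed

section \<open>Growth of the block entries\<close>

text \<open>
  The ratio \<open>y / x\<close> starts as \<open>t\<close> and is multiplied in each step by \<open>p / (p - 1)\<close>, where
  \<open>p = x (2 x + c y)\<close>. A nonzero kick makes \<open>\<bar>p\<bar> \<ge> 2\<close> for large \<open>t\<close>, so at most a factor \<open>2\<close> is lost.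
\<close>

lemma block_growth:
  assumes "\<And>j. j < n \<Longrightarrow> c j \<noteq> 0"
  shows "(\<forall>\<^sub>F t in at_top. 1 \<le> \<bar>block_x c n t\<bar>)
       \<and> filterlim (\<lambda>t. \<bar>block_y c n t\<bar> / \<bar>block_x c n t\<bar>) at_top at_top"
  using assms
proof (induction n)
  case 0
  then show ?case by (simp add: filterlim_abs_real)
next
  case (Suc n)
  let ?x = "block_x c n" and ?y = "block_y c n"
  have x1: "\<forall>\<^sub>F t in at_top. 1 \<le> \<bar>?x t\<bar>"
    and yx: "filterlim (\<lambda>t. \<bar>?y t\<bar> / \<bar>?x t\<bar>) at_top at_top" using Suc by auto
  have c: "0 < \<bar>c n\<bar>" using Suc.prems by auto
  \<comment> \<open>The threshold \<open>4\<close> makes \<open>c y\<close> at least twice as large as \<open>2 x\<close>.\<close>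
  have big: "\<forall>\<^sub>F t in at_top. 4 / \<bar>c n\<bar> \<le> \<bar>?y t\<bar> / \<bar>?x t\<bar>"
    using yx by (simp add: filterlim_at_top)
  have ev: "\<forall>\<^sub>F t in at_top. 1 \<le> \<bar>block_x c (Suc n) t\<bar>
      \<and> (1/2) * (\<bar>?y t\<bar> / \<bar>?x t\<bar>) \<le> \<bar>block_y c (Suc n) t\<bar> / \<bar>block_x c (Suc n) t\<bar>"
    using x1 big
  proof eventually_elim
    case (elim t)
    let ?T = "2 * ?x t + c n * ?y t"
    have "4 * \<bar>?x t\<bar> \<le> \<bar>c n * ?y t\<bar>"
      using elim c by (simp add: divide_simps abs_mult mult.commute split: if_splits)
    then have T: "2 \<le> \<bar>?T\<bar>" using elim(1) by linarith
    have "1 * 2 \<le> \<bar>?x t\<bar> * \<bar>?T\<bar>" using elim(1) T by (intro mult_mono) auto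
    then have p: "2 \<le> \<bar>?x t * ?T\<bar>" by (simp add: abs_mult)
    then have x': "1 \<le> \<bar>?x t * ?T - 1\<bar>" "\<bar>?x t * ?T - 1\<bar> \<le> 2 * \<bar>?x t * ?T\<bar>" by linarith+
    have "(1/2) * (\<bar>?y t\<bar> / \<bar>?x t\<bar>) = \<bar>?y t * ?T\<bar> / (2 * \<bar>?x t * ?T\<bar>)"
    proof -
      have "0 < \<bar>?x t\<bar>" "0 < \<bar>?T\<bar>" using elim(1) T by linarith+
      then show ?thesis by (simp only: abs_mult) (simp add: divide_simps)
    qed
    also have "\<dots> \<le> \<bar>?y t * ?T\<bar> / \<bar>?x t * ?T - 1\<bar>"
      using x' p by (intro divide_left_mono mult_pos_pos) linarith+
    finally show ?case using x' by simp
  qed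
  have "filterlim (\<lambda>t. (1/2) * (\<bar>?y t\<bar> / \<bar>?x t\<bar>)) at_top at_top"
    by (rule filterlim_tendsto_pos_mult_at_top[OF tendsto_const _ yx]) simp
  then have "filterlim (\<lambda>t. \<bar>block_y c (Suc n) t\<bar> / \<bar>block_x c (Suc n) t\<bar>) at_top at_top"
    by (rule filterlim_at_top_mono) (use ev in \<open>eventually_elim, simp\<close>)
  moreover have "\<forall>\<^sub>F t in at_top. 1 \<le> \<bar>block_x c (Suc n) t\<bar>"
    using ev by eventually_elim simp
  ultimately show ?case by blast
qed

lemma diag_poly_nonzero:
  assumes "\<And>j. j < n \<Longrightarrow> c j \<noteq> 0"
  shows "diag_poly c n \<noteq> 0"
proof
  assume "diag_poly c n = 0"
  then have "\<forall>\<^sub>F t::real in at_top. False" using block_growth[of n c] assms by simp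
  then show False by simp
qed

section \<open>Sets of surviving parameters\<close>

text \<open>
  The times beyond \<open>k\<close> that are elliptic for the block \<open>P\<^sub>k\<^sub>+\<^sub>1\<close>, which \<open>c\<^sub>k\<close> completes, and have
  seen only good steps up to the block \<open>P\<^sub>n\<close>. This set depends on \<open>c\<^sub>0, \<dots>, c\<^sub>n\<^sub>-\<^sub>1\<close> only
  (\<open>survivors_cong\<close>), so the kicks can be chosen one after another.
\<close>

definition survivors :: "(nat \<Rightarrow> real) \<Rightarrow> nat \<Rightarrow> nat \<Rightarrow> real set" where
  "survivors c k n = {t. real k < t \<and> (block_x c (Suc k) t)\<^sup>2 < 1 \<and> (\<forall>m. k < m \<and> m < n \<longrightarrow> good_step c m t)}"

lemma survivors_base: "survivors c k (Suc k) = {t. real k < t \<and> (block_x c (Suc k) t)\<^sup>2 < 1}"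
  by (auto simp: survivors_def)

lemma survivors_Suc:
  assumes "k < n"
  shows "survivors c k (Suc n) = {t \<in> survivors c k n. good_step c n t}"
  using assms by (auto simp: survivors_def less_Suc_eq)

lemma survivors_elliptic:
  assumes "k < n" "t \<in> survivors c k n"
  shows "(block_x c n t)\<^sup>2 < 1"
proof -
  obtain m where m: "n = Suc m" using assms(1) by (cases n) auto
  show ?thesis
    using assms by (cases "m = k") (auto simp: m survivors_def good_step_def)
qed

lemma survivors_cong:
  assumes "k < n" "\<And>j. j < n \<Longrightarrow> c j = c' j"
  shows "survivors c k n = survivors c' k n"
proof -
  have *: "diag_poly c i = diag_poly c' i" "upper_poly c i = upper_poly c' i" if "i \<le> n" for i
    using poly_cong_prefix[of i c c'] that assms(2) by auto
  have g: "good_step c m t \<longleftrightarrow> good_step c' m t" if "m < n" for m t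
    using *[of m] *[of "Suc m"] that assms(2)
    by (simp add: good_step_def ratio_def del: diag_poly.simps upper_poly.simps)
  show ?thesis
    using g *[of "Suc k"] assms(1) by (auto simp: survivors_def simp del: diag_poly.simps)
qed

lemma borel_measurable_poly [measurable]: "poly (p :: real poly) \<in> borel_measurable borel"
  by (intro borel_measurable_continuous_onI continuous_intros)

lemma good_step_measurable [measurable]: "Measurable.pred borel (good_step c n)"
  unfolding good_step_def[abs_def] ratio_def by measurable

lemma survivors_sets [measurable]: "survivors c k n \<in> sets borel"
  unfolding survivors_def by measurable

text \<open>
  Nonzero kicks make \<open>\<bar>x\<bar> \<ge> 1\<close> for all large times, so the elliptic set is bounded.
\<close>

lemma survivors_finite_measure:
  assumes "\<And>j. j \<le> k \<Longrightarrow> c j \<noteq> 0"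
  shows "survivors c k n \<in> fmeasurable lborel"
proof -
  obtain T where T: "\<And>t. T \<le> t \<Longrightarrow> 1 \<le> \<bar>block_x c (Suc k) t\<bar>"
    using block_growth[of "Suc k" c] assms by (auto simp: eventually_at_top_linorder)
  have "survivors c k n \<subseteq> {real k..T}"
  proof
    fix t assume t: "t \<in> survivors c k n"
    then have "\<bar>block_x c (Suc k) t\<bar> < 1"
      unfolding survivors_def using abs_square_less_1 by blast
    then show "t \<in> {real k..T}" using T[of t] t by (force simp: survivors_def)
  qed
  moreover have "{real k..T} \<in> fmeasurable lborel"
    by (rule fmeasurableI) (simp_all add: emeasure_lborel_Icc_eq)
  moreover have "survivors c k n \<in> sets lborel"
    by simp
  ultimately show ?thesis
    using fmeasurableI2 by blast
qed

section \<open>Choosing the next kick\<close>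

text \<open>
  As the kick tends to \<open>0\<close>, the new entries tend to \<open>2 x\<^sup>2 - 1\<close> and \<open>2 x y\<close>, the entries of \<open>P\<^sub>n\<^sup>2\<close>, and
  the weight belonging to these is again \<open>\<rho>\<^sub>n\<close>. All conditions of a good step hold strictly in the
  limit. The case \<open>x = 0\<close> is different because then \<open>P\<^sub>n\<^sup>2 = -1\<close>, which is not elliptic.
\<close>

lemma good_step_eventually:
  assumes "(block_x c n t)\<^sup>2 < 1" "block_x c n t \<noteq> 0" "r \<longlonglongrightarrow> 0"
  shows "\<forall>\<^sub>F i in sequentially. good_step (c(n := r i)) n t"
proof -
  let ?x = "block_x c n t" and ?y = "block_y c n t" and ?R = "ratio c n t" and ?e = "(1/2::real)^n"
  let ?X = "\<lambda>i. ?x * (2 * ?x + r i * ?y) - 1" and ?Y = "\<lambda>i. ?y * (2 * ?x + r i * ?y)"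
  have y: "?y \<noteq> 0" by (rule block_y_nonzero[OF assms(1)])
  have R: "0 < ?R" by (rule ratio_pos[OF assms(1)])
  have X: "?X \<longlonglongrightarrow> 2 * ?x\<^sup>2 - 1"
    by (rule tendsto_eq_intros assms(3) refl | simp add: power2_eq_square)+
  have Y: "?Y \<longlonglongrightarrow> 2 * ?x * ?y"
    by (rule tendsto_eq_intros assms(3) refl | simp)+
  have x2: "0 < ?x\<^sup>2" using assms(2) by simp
  have X2: "(\<lambda>i. (?X i)\<^sup>2) \<longlonglongrightarrow> (2 * ?x\<^sup>2 - 1)\<^sup>2" by (intro tendsto_intros X)
  have lt: "(2 * ?x\<^sup>2 - 1)\<^sup>2 < 1"
    using assms(1) x2 by (intro iffD2[OF abs_square_less_1]) (simp add: abs_less_iff)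
  have "(1 - (2 * ?x\<^sup>2 - 1)\<^sup>2) / (2 * ?x * ?y)\<^sup>2 = ?R"
    using y assms(2) by (simp add: ratio_def field_simps power2_eq_square)
  then have Q: "(\<lambda>i. (1 - (?X i)\<^sup>2) / (?Y i)\<^sup>2) \<longlonglongrightarrow> ?R"
    using tendsto_divide[OF tendsto_diff[OF tendsto_const X2] tendsto_power[OF Y, of 2], of 1] y assms(2) by simp
  have r2: "(\<lambda>i. (r i)\<^sup>2) \<longlonglongrightarrow> 0" using tendsto_power[OF assms(3), of 2] by simp
  have e: "0 < ?e" by simp
  have "?R < (1 + ?e) * ?R" using R e by (simp add: algebra_simps)
  then have ev2: "\<forall>\<^sub>F i in sequentially. (1 - (?X i)\<^sup>2) / (?Y i)\<^sup>2 < (1 + ?e) * ?R"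
    by (rule order_tendstoD(2)[OF Q])
  have "(\<lambda>i. (1 + ?e) * ((1 - (?X i)\<^sup>2) / (?Y i)\<^sup>2)) \<longlonglongrightarrow> (1 + ?e) * ?R"
    by (rule tendsto_mult_left[OF Q])
  then have ev3: "\<forall>\<^sub>F i in sequentially. ?R < (1 + ?e) * ((1 - (?X i)\<^sup>2) / (?Y i)\<^sup>2)"
    by (rule order_tendstoD(1)) fact
  have ev4: "\<forall>\<^sub>F i in sequentially. (r i)\<^sup>2 < ?e\<^sup>2 * ?R"
    by (rule order_tendstoD(2)[OF r2]) (use R in simp)
  have ev1: "\<forall>\<^sub>F i in sequentially. (?X i)\<^sup>2 < 1"
    by (rule order_tendstoD(2)[OF X2 lt])
  have pre: "diag_poly (c(n := s)) n = diag_poly c n" "upper_poly (c(n := s)) n = upper_poly c n" for s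
    by (rule poly_cong_prefix; simp)+
  show ?thesis
    using ev1 ev2 ev3 ev4
  proof eventually_elim
    case (elim i)
    then show ?case
      by (simp add: good_step_def ratio_def pre)
  qed
qed

text \<open>
  No uniformity in \<open>t\<close> is available near the zeros of \<open>x\<close> or the edges of the elliptic set; dominated
  convergence replaces it.
\<close>

lemma survivors_measure_tendsto:
  assumes "k < n" "\<And>j. j < n \<Longrightarrow> c j \<noteq> 0" "r \<longlonglongrightarrow> 0"
  shows "(\<lambda>i. measure lborel (survivors (c(n := r i)) k (Suc n)))
           \<longlonglongrightarrow> measure lborel (survivors c k n)"
proof -
  let ?S = "survivors c k n" and ?T = "\<lambda>i. survivors (c(n := r i)) k (Suc n)"
  have fm: "?S \<in> fmeasurable lborel"
    using assms by (intro survivors_finite_measure) auto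
  have T: "?T i = {t \<in> ?S. good_step (c(n := r i)) n t}" for i
    using survivors_Suc[OF assms(1)] survivors_cong[OF assms(1), of "c(n := r i)" c] by simp
  have "finite {t. block_x c n t = 0}"
    using diag_poly_nonzero[of n c] assms(2) by (intro poly_roots_finite) auto
  then have null: "{t. block_x c n t = 0} \<in> null_sets lborel"
    by (intro finite_imp_null_set_lborel)
  have "(\<lambda>i. \<integral>t. indicator (?T i) t \<partial>lborel) \<longlonglongrightarrow> (\<integral>t. indicator ?S t \<partial>lborel :: real)"
  proof (rule integral_dominated_convergence[where w = "indicator ?S"])
    show "AE t in lborel. (\<lambda>i. indicator (?T i) t :: real) \<longlonglongrightarrow> indicator ?S t"
      using AE_not_in[OF null]
    proof eventually_elim
      case (elim t)
      show ?case
      proof (cases "t \<in> ?S")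
        case True
        then have "\<forall>\<^sub>F i in sequentially. good_step (c(n := r i)) n t"
          using survivors_elliptic[OF assms(1)] elim assms(3) by (intro good_step_eventually) auto
        then have "\<forall>\<^sub>F i in sequentially. (indicator (?T i) t :: real) = indicator ?S t"
          by eventually_elim (use True in \<open>simp add: T\<close>)
        then show ?thesis by (rule tendsto_eventually)
      qed (simp add: T)
    qed
    show "integrable lborel (indicator ?S :: real \<Rightarrow> real)"
      using fm by (simp add: fmeasurable_def)
    show "AE t in lborel. norm (indicator (?T i) t :: real) \<le> indicator ?S t" for i
      by (simp add: T indicator_def)
  qed measurable
  moreover have "(\<integral>t. indicator A t \<partial>lborel) = measure lborel A" for A :: "real set"
    by simp
  ultimately show ?thesis by (simp only:)
qed

text \<open>
  For \<open>k = n\<close> the inequality compares a set with itself and says that the elliptic set newly opened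
  by \<open>r\<close> has positive measure. For \<open>k < n\<close> it says that \<open>r\<close> preserves more than half of the \<open>k\<close>-th
  set. Being strict, this inequality survives a small enough further kick, so no budget of losses
  has to be kept.
\<close>

definition admissible :: "(nat \<Rightarrow> real) \<Rightarrow> nat \<Rightarrow> real \<Rightarrow> bool" where
  "admissible c n r \<longleftrightarrow> r \<noteq> 0 \<and>
     (\<forall>k\<le>n. measure lborel (survivors (c(n := r)) k (Suc k)) / 2
              < measure lborel (survivors (c(n := r)) k (Suc n)))"

text \<open>
  The kick \<open>c = (1 / x - 2 x) / y\<close>, evaluated at time \<open>s\<close>, is the one that solves \<open>x (2 x + c y) = 1\<close>,
  i.e. that makes the diagonal of the next block vanish at \<open>s\<close>. It tends to \<open>0\<close> as \<open>s\<close> runs through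
  the natural numbers, so that the sets opened before lose arbitrarily little.
\<close>

lemma admissible_exists:
  assumes "\<And>j. j < n \<Longrightarrow> admissible c j (c j)"
  shows "\<exists>r. admissible c n r"
proof -
  have nz: "c j \<noteq> 0" if "j < n" for j using assms that by (auto simp: admissible_def)
  note growth = block_growth[of n c, OF nz]
  let ?x = "\<lambda>i. block_x c n (real i)" and ?y = "\<lambda>i. block_y c n (real i)"
  define r where "r i = (1 / ?x i - 2 * ?x i) / ?y i" for i :: nat
  have x1: "\<forall>\<^sub>F i in sequentially. 1 \<le> \<bar>?x i\<bar>"
    using eventually_compose_filterlim[OF conjunct1[OF growth] filterlim_real_sequentially] .
  have yx: "filterlim (\<lambda>i. \<bar>?y i\<bar> / \<bar>?x i\<bar>) at_top sequentially"
    using filterlim_compose[OF conjunct2[OF growth] filterlim_real_sequentially] .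
  have y1: "\<forall>\<^sub>F i in sequentially. 1 \<le> \<bar>?y i\<bar> / \<bar>?x i\<bar>"
    using yx by (simp add: filterlim_at_top)
  have bound: "\<forall>\<^sub>F i in sequentially. norm (r i) \<le> 3 * inverse (\<bar>?y i\<bar> / \<bar>?x i\<bar>)"
    using x1
  proof eventually_elim
    case (elim i)
    have "\<bar>1 / ?x i\<bar> \<le> 1" using elim by (simp add: divide_simps)
    then have "\<bar>1 / ?x i - 2 * ?x i\<bar> \<le> 3 * \<bar>?x i\<bar>" using elim by linarith
    then have "\<bar>1 / ?x i - 2 * ?x i\<bar> / \<bar>?y i\<bar> \<le> 3 * \<bar>?x i\<bar> / \<bar>?y i\<bar>"
      by (intro divide_right_mono) auto
    then show ?case by (simp add: r_def)
  qed
  have "(\<lambda>i. 3 * inverse (\<bar>?y i\<bar> / \<bar>?x i\<bar>)) \<longlonglongrightarrow> 0"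
    using tendsto_mult_left[OF tendsto_inverse_0_at_top[OF yx], of 3] by simp
  then have r0: "r \<longlonglongrightarrow> 0" using bound by (rule Lim_null_comparison[rotated])
  have new: "\<forall>\<^sub>F i in sequentially. r i \<noteq> 0 \<and> block_x (c(n := r i)) (Suc n) (real i) = 0 \<and> n < i"
    using x1 y1 eventually_gt_at_top[of n]
  proof eventually_elim
    case (elim i)
    have x: "?x i \<noteq> 0" and y: "?y i \<noteq> 0" using elim by auto
    have "1 \<le> (?x i)\<^sup>2" using elim(1) by (simp add: abs_le_square_iff[of 1, simplified])
    then have "1 / ?x i - 2 * ?x i \<noteq> 0" using x by (simp add: field_simps power2_eq_square)
    then have "r i \<noteq> 0" using y by (simp add: r_def)
    moreover have "diag_poly (c(n := s)) n = diag_poly c n" "upper_poly (c(n := s)) n = upper_poly c n" for s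
      by (rule poly_cong_prefix; simp)+
    then have "block_x (c(n := r i)) (Suc n) (real i) = 0"
      using x y by (simp add: r_def field_simps)
    ultimately show ?case using elim(3) by simp
  qed
  have old: "\<forall>\<^sub>F i in sequentially. \<forall>k\<in>{..<n}.
      measure lborel (survivors (c(n := r i)) k (Suc k)) / 2
        < measure lborel (survivors (c(n := r i)) k (Suc n))"
  proof (intro eventually_ball_finite ballI)
    fix k assume "k \<in> {..<n}"
    then have k: "k < n" by simp
    obtain m where m: "n = Suc m" using k by (cases n) auto
    have "measure lborel (survivors c k (Suc k)) / 2 < measure lborel (survivors c k n)"
      using assms[of m] k by (simp add: admissible_def m)
    from order_tendstoD(1)[OF survivors_measure_tendsto[OF k nz r0] this]
    show "\<forall>\<^sub>F i in sequentially. measure lborel (survivors (c(n := r i)) k (Suc k)) / 2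
        < measure lborel (survivors (c(n := r i)) k (Suc n))"
      using survivors_cong[of k "Suc k" "c(n := r _)" c] k by simp
  qed simp
  obtain i where i: "r i \<noteq> 0" "block_x (c(n := r i)) (Suc n) (real i) = 0" "n < i"
    and oldi: "\<forall>k\<in>{..<n}. measure lborel (survivors (c(n := r i)) k (Suc k)) / 2
        < measure lborel (survivors (c(n := r i)) k (Suc n))"
    using eventually_happens'[OF sequentially_bot eventually_conj[OF new old]] by blast
  let ?c = "c(n := r i)"
  have "0 < measure lborel (survivors ?c n (Suc n))"
  proof -
    have "open (survivors ?c n (Suc n))"
      unfolding survivors_base
      by (intro open_Collect_conj open_Collect_less continuous_intros)
    moreover have "real i \<in> survivors ?c n (Suc n)"
      using i by (simp add: survivors_base del: diag_poly.simps)
    ultimately have "\<not> negligible (survivors ?c n (Suc n))"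
      using open_not_negligible by blast
    moreover have "survivors ?c n (Suc n) \<in> fmeasurable lborel"
      by (rule survivors_finite_measure) (use nz i in auto)
    ultimately show ?thesis
      by (auto simp: negligible_iff_measure zero_less_measure_iff fmeasurable_def)
  qed
  then have "measure lborel (survivors ?c k (Suc k)) / 2 < measure lborel (survivors ?c k (Suc n))"
    if "k \<le> n" for k
    using that oldi by (cases "k = n") auto
  then have "admissible c n (r i)"
    using i(1) unfolding admissible_def by blast
  then show ?thesis by blast
qed

lemma admissible_sequence_exists: "\<exists>c. \<forall>n. admissible c n (c n)"
proof (rule dependent_wf_choice[OF wf_less, where P = admissible])
  fix f g :: "nat \<Rightarrow> real" and n r
  assume eq: "\<And>z. (z, n) \<in> {(x, y). x < y} \<Longrightarrow> f z = g z"
  have "survivors (f(n := r)) k m = survivors (g(n := r)) k m" if "k < m" "m \<le> Suc n" for k m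
    using that eq by (intro survivors_cong) (auto simp: less_Suc_eq)
  then show "admissible f n r = admissible g n r"
    by (simp add: admissible_def)
next
  fix n and f :: "nat \<Rightarrow> real"
  assume "\<And>j. (j, n) \<in> {(x, y). x < y} \<Longrightarrow> admissible f j (f j)"
  then have "admissible f j (f j)" if "j < n" for j using that by blast
  then show "\<exists>r. admissible f n r" by (rule admissible_exists)
qed

section \<open>The set of bounded times\<close>

lemma Hmat_mult_vec: "Hmat t *v w = w + (t * w $ 2) *\<^sub>R axis 1 1"
  by (simp add: Hmat_def matrix_vector_mult_def sum_2 vec_eq_iff forall_2 axis_def)

lemma kick_prod_continuous:
  "continuous_on UNIV (\<lambda>t. kick_prod \<Phi> t K *v v)"
proof (induction K)
  case (Suc K)
  have "continuous_on UNIV (\<lambda>t. Hmat t *v (kick_prod \<Phi> t K *v v))"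
    unfolding Hmat_mult_vec by (intro continuous_intros Suc.IH)
  then show ?case
    unfolding kick_prod.simps matrix_vector_mul_assoc[symmetric]
    by (rule bounded_linear.continuous_on[OF matrix_vector_mul_bounded_linear])
qed simp

text \<open>
  In this form the set is a countable union of closed sets, hence Borel.
\<close>

lemma bounded_times_eq:
  "bounded_times \<Phi> = {0..} \<inter> (\<Union>B::nat. {t. \<forall>K\<ge>1. \<forall>v. norm (kick_prod \<Phi> t K *v v) \<le> real B * norm v})"
proof -
  have "bdd_above ((\<lambda>K. onorm ((*v) (kick_prod \<Phi> t K))) ` {1..})
    \<longleftrightarrow> (\<exists>B::nat. \<forall>K\<ge>1. \<forall>v. norm (kick_prod \<Phi> t K *v v) \<le> real B * norm v)" for t
  proof
    assume "bdd_above ((\<lambda>K. onorm ((*v) (kick_prod \<Phi> t K))) ` {1..})"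
    then obtain M where M: "\<And>K. 1 \<le> K \<Longrightarrow> onorm ((*v) (kick_prod \<Phi> t K)) \<le> M"
      by (auto simp: bdd_above_def)
    obtain B :: nat where B: "M \<le> real B" using real_arch_simple by blast
    have "norm (kick_prod \<Phi> t K *v v) \<le> real B * norm v" if "1 \<le> K" for K v
    proof -
      have "onorm ((*v) (kick_prod \<Phi> t K)) \<le> real B" using M[OF that] B by linarith
      then show ?thesis
        using onorm[OF matrix_vector_mul_bounded_linear, of "kick_prod \<Phi> t K" v]
        by (meson mult_right_mono norm_ge_zero order_trans)
    qed
    then show "\<exists>B::nat. \<forall>K\<ge>1. \<forall>v. norm (kick_prod \<Phi> t K *v v) \<le> real B * norm v" by blast
  next
    assume "\<exists>B::nat. \<forall>K\<ge>1. \<forall>v. norm (kick_prod \<Phi> t K *v v) \<le> real B * norm v"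
    then show "bdd_above ((\<lambda>K. onorm ((*v) (kick_prod \<Phi> t K))) ` {1..})"
      by (meson atLeast_iff bdd_aboveI2 onorm_le)
  qed
  then show ?thesis by (auto simp: bounded_times_def)
qed

lemma bounded_times_borel: "bounded_times \<Phi> \<in> sets borel"
proof -
  have "closed {t. \<forall>K\<ge>1. \<forall>v. norm (kick_prod \<Phi> t K *v v) \<le> real B * norm v}" for B
  proof -
    have "{t. \<forall>K\<ge>1. \<forall>v. norm (kick_prod \<Phi> t K *v v) \<le> real B * norm v}
        = (\<Inter>K\<in>{1..}. \<Inter>v. {t. norm (kick_prod \<Phi> t K *v v) \<le> real B * norm v})" by auto
    also have "closed \<dots>"
      by (intro closed_INT ballI closed_Collect_le continuous_on_norm kick_prod_continuous continuous_on_const)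
    finally show ?thesis .
  qed
  then show ?thesis
    unfolding bounded_times_eq by (intro sets.Int sets.countable_UN'' borel_closed) auto
qed

theorem theorem3:
  shows "\<exists>c :: nat \<Rightarrow> real. (\<forall>j. c j \<noteq> 0) \<and>
           essentially_unbounded (bounded_times (\<lambda>k. Mmat (c (multiplicity 2 k))))"
proof -
  obtain c where c: "\<And>n. admissible c n (c n)" using admissible_sequence_exists by blast
  have nz: "c j \<noteq> 0" for j using c[of j] by (simp add: admissible_def)
  have half: "measure lborel (survivors c k (Suc k)) / 2 < measure lborel (survivors c k (Suc n))"
    if "k \<le> n" for k n
    using c[of n] that by (simp add: admissible_def)
  have "0 < emeasure lebesgue (bounded_times (ruler c) \<inter> {a..})" for a :: real
  proof -
    obtain k :: nat where k: "a \<le> real k" using real_arch_simple by blast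
    \<comment> \<open>The times opened by \<open>c\<^sub>k\<close> shrink to a limit set that keeps at least half of their measure.\<close>
    define A where "A i = survivors c k (Suc (k + i))" for i
    have fm: "A i \<in> fmeasurable lborel" for i
      unfolding A_def by (rule survivors_finite_measure) (rule nz)
    have "(\<lambda>i. measure lborel (A i)) \<longlonglongrightarrow> measure lborel (\<Inter>i. A i)"
    proof (rule Lim_measure_decseq)
      show "decseq A" by (auto simp: decseq_def A_def survivors_def)
    qed (use fmeasurableD[OF fm] fmeasurableD2[OF fm] in auto)
    moreover have "measure lborel (A 0) / 2 \<le> measure lborel (A i)" for i
      using half[of k "k + i"] by (simp add: A_def)
    ultimately have "measure lborel (A 0) / 2 \<le> measure lborel (\<Inter>i. A i)"
      by (intro tendsto_lowerbound[where F = sequentially]) auto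
    moreover have "0 < measure lborel (A 0)" using half[of k k] by (simp add: A_def)
    ultimately have pos: "0 < measure lborel (\<Inter>i. A i)" by linarith
    then have pos: "0 < emeasure lborel (\<Inter>i. A i)"
      by (auto simp: measure_def zero_less_iff_neq_zero)
    have sub: "(\<Inter>i. A i) \<subseteq> bounded_times (ruler c) \<inter> {a..}"
    proof
      fix t assume t: "t \<in> (\<Inter>i. A i)"
      have A0: "real k < t" "(block_x c (Suc k) t)\<^sup>2 < 1"
        using t by (auto simp: A_def survivors_def)
      have "good_step c n t" if "Suc k \<le> n" for n
      proof -
        have "t \<in> A n" using t by blast
        then show ?thesis using that by (auto simp: A_def survivors_def)
      qed
      then obtain B where "\<And>K v. norm (kick_prod (ruler c) t K *v v) \<le> B * norm v"
        using bounded_of_good_steps[OF A0(2)] by blast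
      then have "bdd_above ((\<lambda>K. onorm ((*v) (kick_prod (ruler c) t K))) ` {1..})"
        by (meson bdd_aboveI2 onorm_le)
      then show "t \<in> bounded_times (ruler c) \<inter> {a..}"
        using A0(1) k by (auto simp: bounded_times_def)
    qed
    have m: "bounded_times (ruler c) \<inter> {a..} \<in> sets borel"
      using bounded_times_borel by auto
    note pos
    also have "emeasure lborel (\<Inter>i. A i) \<le> emeasure lborel (bounded_times (ruler c) \<inter> {a..})"
      using sub m by (intro emeasure_mono) auto
    also have "\<dots> = emeasure lebesgue (bounded_times (ruler c) \<inter> {a..})"
      using m by simp
    finally show ?thesis .
  qed
  then show ?thesis using nz unfolding essentially_unbounded_def by blast
qed

end
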